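(* Let $T$ be an integral domain of the form $T=K+M$, where $K$ is a subfield of $T$ and $M$ is a nonzero maximal ideal of $T$. Let $D$ be a subfield of $K$ and $R=D+M$. Then the following statements hold. (1) If $\mathcal{A}(R)\cap M\neq\emptyset$, then $R$ is a TPDF-domain if and only if $T$ is a TPDF-domain, each element of $\mathcal{A}(R)\cap M$ is prime in $R$, and $|K^*/D^*|<\infty$. (2) If $\mathcal{A}(R)\cap M=\emptyset$, then $R$ is a TPDF-domain if and only if $T$ is a TPDF-domain.
   Context: For an integral domain $A$: an irreducible element of $A$ is a nonunit $a$ such that $a=bc$ implies that $b$ or $c$ is a unit of $A$, and $\mathcal{A}(A)$ denotes the set of irreducible elements of $A$; a prime element of $A$ is a nonzero nonunit $p$ such that $p\mid ab$ implies $p\mid a$ or $p\mid b$. $A$ is a TPDF-domain if every nonzero nonunit of $A$ has at least one prime divisor in $A$ and every nonzero element of $A$ has only finitely many prime divisors up to associates. For a field $F$, $F^*=F\setminus\{0\}$ is its multiplicative group. *)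

theory Defs
  imports "HOL-Algebra.Ring_Divisibility" "HOL-Algebra.Subrings"
begin

definition irreducibles :: "('a, 'b) ring_scheme \<Rightarrow> 'a set" where
  "irreducibles A = {a \<in> carrier A. ring_irreducible\<^bsub>A\<^esub> a}"

(* The library defines irreducibility by proper factors; in a domain this is the usual
   condition on factorizations a = bc. Zero needs no separate exclusion on the right:
   it is a nonunit that factors as 0 = 0 * 0. *)
lemma (in domain) mem_irreducibles_iff:
  "a \<in> irreducibles R \<longleftrightarrow>
     a \<in> carrier R \<and> a \<notin> Units R \<and>
     (\<forall>b \<in> carrier R. \<forall>c \<in> carrier R. a = b \<otimes> c \<longrightarrow> b \<in> Units R \<or> c \<in> Units R)"
proof (cases "a \<in> carrier R \<and> a \<noteq> \<zero>")
  case True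
  then show ?thesis
    unfolding irreducibles_def
    using ring_irreducibleE(4,5)[of a] ring_irreducibleI[of a] by blast
next
  case False
  have "\<zero> = \<zero> \<otimes> \<zero>" by simp
  then show ?thesis
    using False unfolding irreducibles_def ring_irreducible_def by blast
qed

definition prime_divisors :: "('a, 'b) ring_scheme \<Rightarrow> 'a \<Rightarrow> 'a set" where
  "prime_divisors A a = {p \<in> carrier A. ring_prime\<^bsub>A\<^esub> p \<and> p divides\<^bsub>A\<^esub> a}"

(* Finiteness up to associates: the prime divisors meet finitely many associate classes. *)
definition TPDF_domain :: "('a, 'b) ring_scheme \<Rightarrow> bool" where
  "TPDF_domain A \<longleftrightarrow>
     domain A \<and>
     (\<forall>a \<in> carrier A - {\<zero>\<^bsub>A\<^esub>}. a \<notin> Units A \<longrightarrow> prime_divisors A a \<noteq> {}) \<and>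
     (\<forall>a \<in> carrier A - {\<zero>\<^bsub>A\<^esub>}. finite (assocs A ` prime_divisors A a))"

end

theory Submission
  imports Defs
begin

text \<open>
Everything rests on two features of \<open>R = D + M\<close> inside \<open>T = K + M\<close>. Every element of \<open>T\<close> becomes
an element of \<open>R\<close> after multiplication by a unit of \<open>T\<close>: divide \<open>k + m\<close> by \<open>k\<close> when \<open>k \<noteq> 0\<close>; elements
of \<open>M\<close> are in \<open>R\<close> already. And an element \<open>p = d + m\<close> of \<open>R\<close> outside \<open>M\<close> divides an element of \<open>R\<close>
within \<open>R\<close> as soon as it does so in \<open>T\<close>: if \<open>p (k + n)\<close> lies in \<open>R\<close>, then its \<open>K\<close>-component \<open>d k\<close> lies
in \<open>D\<close>, hence so does \<open>k\<close>. The locale \<open>unit_dense_subring\<close> records just these two features.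

They imply that \<open>R\<close> and \<open>T\<close> have the same primes outside \<open>M\<close>, up to units of \<open>T\<close>, and that
such primes in \<open>R\<close> divide the same elements of \<open>R\<close>, and have the same associates there, in both rings
(\<open>prime_subring_iff\<close>, \<open>divides_subring_iff\<close>). If \<open>R\<close> has no
irreducible in \<open>M\<close>, then neither \<open>R\<close> nor \<open>T\<close> has a prime in \<open>M\<close>, since primes are irreducible and an
element of \<open>M\<close> irreducible in \<open>T\<close> is irreducible in \<open>R\<close>. So all primes lie outside \<open>M\<close>, and the
existence and the finiteness of prime divisors pass between the two rings (\<open>TPDF_subring_iff\<close>).
This is the second part.

In the first part the behaviour is all or nothing. If \<open>D = K\<close>, then \<open>R = T\<close>, the quotient group is
trivial, and irreducibles of a TPDF-domain are prime, so the equivalence is immediate. If some \<open>k\<close>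
lies in \<open>K\<close> but not in \<open>D\<close>, then no \<open>p \<in> M\<close> is prime in \<open>R\<close>: \<open>p\<close> divides \<open>(k p) (k\<inverse> p) = p p\<close> but
neither factor (\<open>not_prime_in_M_if_new_unit\<close>). An irreducible of \<open>R\<close> in \<open>M\<close> then is not prime, so
\<open>R\<close> is not a TPDF-domain and the right-hand side fails as well.
\<close>

section \<open>Primes, irreducibles and classes of associates in domains\<close>

lemma (in domain) ring_prime_if_associated:
  assumes "p \<in> carrier R" "q \<in> carrier R" "ring_prime p" "p \<sim> q"
  shows "ring_prime q"
proof -
  have pq: "p divides q" "q divides p"
    using assms(4) by (auto simp: associated_def)
  have p: "p \<noteq> \<zero>" "prime R p"
    using ring_primeE[OF assms(1,3)] by auto
  have "q \<noteq> \<zero>"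
    using pq(2) p(1) zero_divides by auto
  moreover have "q \<notin> Units R"
    using divides_unit[OF pq(1) assms(1)] p(2) by (auto simp: prime_def)
  moreover have "q divides a \<or> q divides b"
    if "a \<in> carrier R" "b \<in> carrier R" "q divides a \<otimes> b" for a b
    using that p(2) divides_trans[OF pq(1) that(3) assms(1)] divides_trans[OF pq(2) _ assms(2)]
    unfolding prime_def by blast
  ultimately show ?thesis
    unfolding ring_prime_def prime_def by blast
qed

lemma (in domain) irreducible_if_ring_prime:
  assumes "p \<in> carrier R" "ring_prime p"
  shows "p \<in> irreducibles R"
  using mult_of.prime_irreducible ring_primeE[OF assms] ring_irreducibleI'[of p] assms(1)
  by (simp add: irreducibles_def)

text \<open>An irreducible element is associated to each of its prime divisors, and a TPDF-domain
provides one.\<close>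
lemma (in domain) irreducible_imp_prime_if_TPDF:
  assumes "TPDF_domain R" "a \<in> irreducibles R"
  shows "ring_prime a"
proof -
  have a: "a \<in> carrier R" "ring_irreducible a"
    using assms(2) by (auto simp: irreducibles_def)
  note irr = ring_irreducibleE[OF a]
  obtain p where p: "p \<in> carrier R" "ring_prime p" "p divides a"
    using assms(1) a(1) irr(1,4) by (fastforce simp: TPDF_domain_def prime_divisors_def)
  obtain c where c: "c \<in> carrier R" "a = p \<otimes> c"
    using p(3) by (auto simp: factor_def)
  have "c \<in> Units R"
    using irr(5)[OF p(1) c] p(2) by (auto simp: ring_prime_def prime_def)
  then have "a \<sim> p"
    by (rule associatedI2[OF _ c(2) p(1)])
  then show ?thesis
    by (rule ring_prime_if_associated[OF p(1) a(1) p(2) associated_sym])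
qed

text \<open>A map that reflects association induces an injection on classes of associates. This is how
finiteness up to associates passes between two rings with different units.\<close>
lemma finite_assocs_if_reflecting_map:
  assumes "comm_monoid G" "comm_monoid H"
    and "A \<subseteq> carrier G" "finite (assocs G ` A)"
    and "B \<subseteq> carrier H" "f ` B \<subseteq> A"
    and "\<And>b b'. b \<in> B \<Longrightarrow> b' \<in> B \<Longrightarrow> f b \<sim>\<^bsub>G\<^esub> f b' \<Longrightarrow> b \<sim>\<^bsub>H\<^esub> b'"
  shows "finite (assocs H ` B)"
proof -
  interpret G: comm_monoid G by fact
  interpret H: comm_monoid H by fact
  \<comment> \<open>\<open>g\<close> inverts the induced map on classes: it picks an element of \<open>B\<close> over a class of \<open>G\<close>.\<close>
  define g where "g C = (SOME b. b \<in> B \<and> assocs G (f b) = C)" for C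
  have "assocs H b = assocs H (g (assocs G (f b)))" if b: "b \<in> B" for b
  proof -
    define b' where "b' = g (assocs G (f b))"
    have b': "b' \<in> B" "assocs G (f b') = assocs G (f b)"
      using someI[of "\<lambda>b'. b' \<in> B \<and> assocs G (f b') = assocs G (f b)" b] b
      unfolding b'_def g_def by blast+
    have "f b \<in> carrier G"
      using assms(3,6) b by blast
    then have "f b' \<sim>\<^bsub>G\<^esub> f b"
      using G.assocs_eqD[OF b'(2)[symmetric]] b'(1) assms(3,6) G.associated_sym by blast
    then have "b' \<sim>\<^bsub>H\<^esub> b"
      by (rule assms(7)[OF b'(1) b])
    then have "b \<in> assocs H b'"
      using assms(5) b H.associated_sym by (auto simp: eq_closure_of_def elem_def)
    then show ?thesis
      using H.assocs_repr_independence[of b b'] assms(5) b'(1) unfolding b'_def by blast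
  qed
  then have "assocs H ` B = (\<lambda>b. assocs H (g (assocs G (f b)))) ` B"
    by (rule image_cong[OF refl])
  also have "\<dots> = (\<lambda>C. assocs H (g C)) ` assocs G ` f ` B"
    by (simp only: image_image)
  finally show ?thesis
    using finite_subset[OF image_mono[OF assms(6)] assms(4)] by simp
qed

section \<open>Subrings meeting every class of associates\<close>

text \<open>The features of \<open>D + M\<close> in \<open>K + M\<close> that govern divisibility. By \<open>scale\<close>, the subring meets every
class of associates of \<open>T\<close>; by \<open>cancel\<close>, quotients by elements outside \<open>M\<close> do not leave it. The
condition \<open>p \<notin> M\<close> matters there: for \<open>p \<in> M\<close> every product \<open>p t\<close> lies in \<open>M\<close>, hence in \<open>S\<close>, so that
cancelling \<open>p\<close> would give \<open>S = T\<close>.\<close>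
locale unit_dense_subring = domain T for T (structure) +
  fixes S M
  assumes subring: "subring S T"
    and ideal: "ideal M T"
    and M_subset: "M \<subseteq> S"
    and one_notin_M: "\<one> \<notin> M"
    and scale: "x \<in> carrier T \<Longrightarrow> \<exists>u \<in> Units T. u \<otimes> x \<in> S"
    and cancel: "\<lbrakk>p \<in> S; p \<notin> M; t \<in> carrier T; p \<otimes> t \<in> S\<rbrakk> \<Longrightarrow> t \<in> S"
begin

abbreviation "R \<equiv> T\<lparr>carrier := S\<rparr>"

lemmas S_closed = subringE(6)[OF subring] and S_carrier = subringE(1)[OF subring, THEN subsetD]

sublocale R: domain R
  rewrites "carrier R = S" and "mult R = mult T" and "one R = one T" and "zero R = zero T"
  using subring_is_domain[OF subring] by simp_all

lemma unit_notin_M: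
  assumes "u \<in> Units T"
  shows "u \<notin> M"
  using ideal.I_r_closed[OF ideal, of u "inv u"] assms one_notin_M by auto

text \<open>A unit lies outside every proper ideal, so its inverse is obtained by a cancellation that
stays in the subring.\<close>
lemma Units_subring: "Units R = Units T \<inter> S"
proof
  show "Units R \<subseteq> Units T \<inter> S"
    using S_carrier by (auto simp: Units_def)
next
  show "Units T \<inter> S \<subseteq> Units R"
  proof
    fix u assume u: "u \<in> Units T \<inter> S"
    have "inv u \<in> S"
      using cancel[of u "inv u"] u unit_notin_M subringE(3)[OF subring] by auto
    then show "u \<in> Units R"
      using u by (auto simp: Units_def[of R] intro!: bexI[of _ "inv u"])
  qed
qed

lemma divides_subring_iff:
  assumes "p \<in> S" "p \<notin> M" "a \<in> S"
  shows "p divides\<^bsub>R\<^esub> a \<longleftrightarrow> p divides a"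
proof
  assume "p divides\<^bsub>R\<^esub> a"
  then show "p divides a"
    using S_carrier by (auto simp: factor_def)
next
  assume "p divides a"
  then obtain t where "t \<in> carrier T" "a = p \<otimes> t"
    by (auto simp: factor_def)
  then show "p divides\<^bsub>R\<^esub> a"
    using cancel[OF assms(1,2)] assms(3) by (auto simp: factor_def)
qed

lemma unit_mult_associated:
  assumes "u \<in> Units T" "x \<in> carrier T"
  shows "u \<otimes> x \<sim> x"
  using assms ring_associated_iff[OF m_closed[OF Units_closed]] by blast

lemma divides_cong_associated:
  assumes "a \<in> carrier T" "b \<in> carrier T" "p \<in> carrier T" "a \<sim> b"
  shows "p divides a \<longleftrightarrow> p divides b"
  using assms(4) divides_trans[OF _ _ assms(3)] unfolding associated_def by blast

text \<open>To test primality in \<open>T\<close>, both factors are first moved into \<open>S\<close> by units of \<open>T\<close>; for elements of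
\<open>S\<close> the two divisibility relations by \<open>p\<close> agree.\<close>
lemma prime_subring_iff:
  assumes p: "p \<in> S" "p \<notin> M"
  shows "ring_prime\<^bsub>R\<^esub> p \<longleftrightarrow> ring_prime p"
proof
  assume prime: "ring_prime p"
  have "p divides\<^bsub>R\<^esub> a \<or> p divides\<^bsub>R\<^esub> b"
    if "a \<in> S" "b \<in> S" "p divides\<^bsub>R\<^esub> a \<otimes> b" for a b
    using that prime S_carrier S_closed divides_subring_iff[OF p]
    by (simp add: ring_prime_def prime_def)
  then show "ring_prime\<^bsub>R\<^esub> p"
    using prime Units_subring by (simp add: ring_prime_def prime_def)
next
  assume R: "ring_prime\<^bsub>R\<^esub> p"
  have pT: "p \<in> carrier T"
    using p(1) by (rule S_carrier)
  have "p divides a \<or> p divides b"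
    if ab: "a \<in> carrier T" "b \<in> carrier T" "p divides a \<otimes> b" for a b
  proof -
    obtain u v where u: "u \<in> Units T" "u \<otimes> a \<in> S" and v: "v \<in> Units T" "v \<otimes> b \<in> S"
      using scale ab(1,2) by meson
    have "(u \<otimes> a) \<otimes> (v \<otimes> b) = (u \<otimes> v) \<otimes> (a \<otimes> b)"
      using u(1) v(1) ab(1,2) Units_closed by (simp add: m_ac)
    then have "p divides (u \<otimes> a) \<otimes> (v \<otimes> b)"
      using divides_prod_l[of p "a \<otimes> b" "u \<otimes> v"] ab pT u(1) v(1) Units_closed by simp
    then have "p divides\<^bsub>R\<^esub> (u \<otimes> a) \<otimes> (v \<otimes> b)"
      using divides_subring_iff[OF p] S_closed[OF u(2) v(2)] by simp
    then have "p divides u \<otimes> a \<or> p divides v \<otimes> b"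
      using R u(2) v(2) divides_subring_iff[OF p] by (simp add: ring_prime_def prime_def)
    then show ?thesis
      using divides_cong_associated[OF _ ab(1) pT unit_mult_associated[OF u(1) ab(1)]]
        divides_cong_associated[OF _ ab(2) pT unit_mult_associated[OF v(1) ab(2)]]
        S_carrier u(2) v(2) by blast
  qed
  then show "ring_prime p"
    using R p Units_subring by (simp add: ring_prime_def prime_def)
qed

lemma irreducible_subring_if_irreducible:
  assumes "a \<in> irreducibles T" "a \<in> M"
  shows "a \<in> irreducibles R"
  using assms M_subset S_carrier Units_subring
  unfolding mem_irreducibles_iff R.mem_irreducibles_iff by blast

text \<open>A prime in \<open>M\<close> of either ring would be irreducible there, hence an irreducible of \<open>R\<close> in \<open>M\<close>.\<close>
lemma no_prime_in_M:
  assumes "irreducibles R \<inter> M = {}" "p \<in> M"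
  shows "\<not> ring_prime\<^bsub>R\<^esub> p" "\<not> ring_prime p"
proof -
  have "p \<in> S" "p \<in> carrier T"
    using assms(2) M_subset S_carrier by auto
  then show "\<not> ring_prime\<^bsub>R\<^esub> p" "\<not> ring_prime p"
    using assms irreducible_subring_if_irreducible[of p] irreducible_if_ring_prime
      R.irreducible_if_ring_prime by blast+
qed

text \<open>All primes now lie outside \<open>M\<close>, so for \<open>x \<in> S\<close> the prime divisors of \<open>x\<close> in \<open>R\<close> are those in \<open>T\<close>
that belong to \<open>S\<close>. From \<open>R\<close> to \<open>T\<close>, both \<open>x\<close> and its prime divisors are scaled into \<open>S\<close>; from \<open>T\<close>
to \<open>R\<close>, a prime divisor in \<open>T\<close> is scaled into \<open>S\<close>.\<close>
lemma TPDF_subring_iff: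
  assumes "irreducibles R \<inter> M = {}"
  shows "TPDF_domain R \<longleftrightarrow> TPDF_domain T"
proof -
  have PD: "prime_divisors R x = prime_divisors T x \<inter> S" if x: "x \<in> S" for x
  proof (rule Set.set_eqI)
    fix p
    show "p \<in> prime_divisors R x \<longleftrightarrow> p \<in> prime_divisors T x \<inter> S"
      using no_prime_in_M[OF assms, of p] prime_subring_iff[of p] divides_subring_iff[OF _ _ x, of p]
        S_carrier[of p]
      by (cases "p \<in> M") (simp_all add: prime_divisors_def conj_ac cong: conj_cong)
  qed
  have PD_cong: "prime_divisors T x = prime_divisors T y"
    if "x \<in> carrier T" "y \<in> carrier T" "x \<sim> y" for x y
    using that divides_cong_associated by (auto simp: prime_divisors_def)
  have PD_assoc: "u \<otimes> p \<in> prime_divisors T x"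
    if p: "p \<in> prime_divisors T x" and u: "u \<in> Units T" for u p x
  proof -
    have p': "p \<in> carrier T" "ring_prime p" "p divides x" "u \<otimes> p \<in> carrier T"
      using p u by (auto simp: prime_divisors_def)
    have "u \<otimes> p \<sim> p" using unit_mult_associated u p' by simp
    then show ?thesis
      using p' ring_prime_if_associated[of p "u \<otimes> p"] divides_trans[of "u \<otimes> p" p x]
      by (auto simp: prime_divisors_def associated_def)
  qed
  have nz: "u \<otimes> x \<noteq> \<zero>" if "u \<in> Units T" "x \<in> carrier T" "x \<noteq> \<zero>" for u x
    using that Units_l_cancel[of u x \<zero>] Units_closed by auto
  have nu: "u \<otimes> x \<notin> Units T" if "u \<in> Units T" "x \<in> carrier T" "x \<notin> Units T" for u x
    using that unit_factor[of x u] m_comm[of u x] by auto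
  have R_iff: "a \<sim>\<^bsub>R\<^esub> b \<longleftrightarrow> a \<sim> b"
    if "a \<in> prime_divisors R x" "b \<in> prime_divisors R y" for a b x y
  proof -
    have "a \<in> S" "b \<in> S" "a \<notin> M" "b \<notin> M"
      using that no_prime_in_M[OF assms] by (auto simp: prime_divisors_def)
    then show ?thesis
      by (simp add: associated_def divides_subring_iff)
  qed
  show ?thesis
  proof
    assume R: "TPDF_domain R"
    have "(x \<notin> Units T \<longrightarrow> prime_divisors T x \<noteq> {}) \<and> finite (assocs T ` prime_divisors T x)"
      if x: "x \<in> carrier T - {\<zero>}" for x
    proof -
      obtain u where u: "u \<in> Units T" "u \<otimes> x \<in> S"
        using scale x by blast
      have ux: "prime_divisors R (u \<otimes> x) = prime_divisors T x \<inter> S"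
        using PD[OF u(2)] PD_cong[OF _ _ unit_mult_associated] u x S_carrier by auto
      have nzux: "u \<otimes> x \<in> S - {\<zero>}" using nz u x by auto
      have "prime_divisors T x \<noteq> {}" if "x \<notin> Units T"
        using R nzux ux nu[of u x] that u x Units_subring unfolding TPDF_domain_def by auto
      moreover have "finite (assocs T ` prime_divisors T x)"
      proof -
        obtain w where w: "\<And>p. p \<in> carrier T \<Longrightarrow> w p \<in> Units T \<and> w p \<otimes> p \<in> S"
          using scale by metis
        have w': "w p \<otimes> p \<in> prime_divisors R (u \<otimes> x)" "p \<in> carrier T" if "p \<in> prime_divisors T x" for p
          using that w[of p] PD_assoc ux by (auto simp: prime_divisors_def)
        show ?thesis
        proof (rule finite_assocs_if_reflecting_map[of R T "prime_divisors R (u \<otimes> x)" _ "\<lambda>p. w p \<otimes> p"])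
          show "comm_monoid R" "comm_monoid T" by unfold_locales
          show "prime_divisors R (u \<otimes> x) \<subseteq> carrier R" "prime_divisors T x \<subseteq> carrier T"
            by (auto simp: prime_divisors_def)
          show "finite (assocs R ` prime_divisors R (u \<otimes> x))"
            using R nzux unfolding TPDF_domain_def by auto
          show "(\<lambda>p. w p \<otimes> p) ` prime_divisors T x \<subseteq> prime_divisors R (u \<otimes> x)"
            using w' by auto
        next
          fix p q assume pq: "p \<in> prime_divisors T x" "q \<in> prime_divisors T x"
            "w p \<otimes> p \<sim>\<^bsub>R\<^esub> w q \<otimes> q"
          then have "w p \<otimes> p \<sim> w q \<otimes> q" using R_iff w' by blast
          moreover have "w p \<otimes> p \<sim> p" "w q \<otimes> q \<sim> q"
            using unit_mult_associated w w'(2) pq by auto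
          ultimately show "p \<sim> q"
            using w w'(2) pq by (meson Units_closed associated_sym associated_trans m_closed)
        qed
      qed
      ultimately show ?thesis by blast
    qed
    then show "TPDF_domain T"
      using domain_axioms unfolding TPDF_domain_def by blast
  next
    assume T: "TPDF_domain T"
    have "(x \<notin> Units R \<longrightarrow> prime_divisors R x \<noteq> {}) \<and> finite (assocs R ` prime_divisors R x)"
      if x: "x \<in> S - {\<zero>}" for x
    proof -
      have "prime_divisors R x \<noteq> {}" if nux: "x \<notin> Units R"
      proof -
        obtain p where p: "p \<in> prime_divisors T x"
          using T x nux Units_subring S_carrier unfolding TPDF_domain_def by blast
        obtain u where "u \<in> Units T" "u \<otimes> p \<in> S"
          using scale p by (auto simp: prime_divisors_def)
        then show ?thesis
          using PD PD_assoc p x by blast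
      qed
      moreover have "finite (assocs R ` prime_divisors R x)"
      proof (rule finite_assocs_if_reflecting_map[of T R "prime_divisors T x" _ "\<lambda>p. p"])
        show "comm_monoid R" "comm_monoid T" by unfold_locales
        show "prime_divisors R x \<subseteq> carrier R" "prime_divisors T x \<subseteq> carrier T"
          by (auto simp: prime_divisors_def)
        show "finite (assocs T ` prime_divisors T x)"
          using T x S_carrier unfolding TPDF_domain_def by auto
        show "(\<lambda>p. p) ` prime_divisors R x \<subseteq> prime_divisors T x"
          using PD x by auto
      qed (use R_iff in blast)
      ultimately show ?thesis by blast
    qed
    then show "TPDF_domain R"
      using R.domain_axioms unfolding TPDF_domain_def by simp
  qed
qed

text \<open>The obstruction is \<open>(v p) (inv v p) = p p\<close>. Both factors lie in \<open>M\<close>, hence in \<open>S\<close>, but their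
quotients by \<open>p\<close> are \<open>v\<close> and \<open>inv v\<close>, which do not.\<close>
lemma not_prime_in_M_if_new_unit:
  assumes v: "v \<in> Units T" "v \<notin> S" "inv v \<notin> S" and p: "p \<in> M"
  shows "\<not> ring_prime\<^bsub>R\<^esub> p"
proof
  assume prime: "ring_prime\<^bsub>R\<^esub> p"
  have pT: "p \<in> carrier T" "p \<noteq> \<zero>"
    using p M_subset S_carrier prime by (auto simp: ring_prime_def)
  have M: "v \<otimes> p \<in> M" "inv v \<otimes> p \<in> M"
    using ideal.I_l_closed[OF ideal p] v(1) by auto
  have notdvd: "\<not> p divides\<^bsub>R\<^esub> w \<otimes> p" if w: "w \<in> carrier T" "w \<notin> S" for w
  proof
    assume "p divides\<^bsub>R\<^esub> w \<otimes> p"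
    then obtain c where "c \<in> S" "w \<otimes> p = p \<otimes> c"
      by (auto simp: factor_def)
    then have "c = w"
      using pT w S_carrier[of c] m_lcancel[of p c w] m_comm by auto
    then show False using \<open>c \<in> S\<close> w by simp
  qed
  have "(v \<otimes> p) \<otimes> (inv v \<otimes> p) = (v \<otimes> inv v) \<otimes> (p \<otimes> p)"
    using v(1) pT(1) Units_closed by (simp add: m_ac del: Units_r_inv Units_l_inv)
  also have "\<dots> = p \<otimes> p" using v(1) pT by simp
  finally have "p divides\<^bsub>R\<^esub> (v \<otimes> p) \<otimes> (inv v \<otimes> p)"
    using p M_subset by (auto simp: factor_def)
  then have "p divides\<^bsub>R\<^esub> v \<otimes> p \<or> p divides\<^bsub>R\<^esub> inv v \<otimes> p"
    using prime M[THEN subsetD[OF M_subset]] by (simp add: ring_prime_def prime_def)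
  then show False
    using notdvd v by auto
qed

end

section \<open>Subrings of the form subfield plus ideal\<close>

lemma (in domain) subfield_subset_Units:
  assumes "subfield K R" "k \<in> K" "k \<noteq> \<zero>"
  shows "k \<in> Units R" "inv k \<in> K"
proof -
  have inv: "inv k \<in> K" "k \<otimes> inv k = \<one>" "inv k \<otimes> k = \<one>"
    using subfield_m_inv[OF assms(1), of k] assms by auto
  then show "inv k \<in> K" by simp
  have "k \<in> carrier R" "inv k \<in> carrier R"
    using subfieldE(3)[OF assms(1)] assms(2) inv(1) by auto
  then show "k \<in> Units R"
    using inv unfolding Units_def by blast
qed

lemma (in domain) subfield_inter_ideal:
  assumes "subfield K R" "ideal M R" "\<one> \<notin> M"
  shows "K \<inter> M \<subseteq> {\<zero>}"
proof
  fix k assume k: "k \<in> K \<inter> M"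
  show "k \<in> {\<zero>}"
  proof (rule ccontr)
    assume "k \<notin> {\<zero>}"
    then have "k \<in> Units R" using subfield_subset_Units assms(1) k by auto
    then have "k \<otimes> inv k \<in> M"
      using ideal.I_r_closed[OF assms(2)] k by blast
    then show False using \<open>k \<in> Units R\<close> assms(3) by simp
  qed
qed

lemma set_add_memI:
  fixes R (structure)
  assumes "h \<in> H" "k \<in> K"
  shows "h \<oplus> k \<in> H <+>\<^bsub>R\<^esub> K"
  using assms by (auto simp: set_add_def')

lemma (in domain) subring_add_ideal:
  assumes D: "subring D R" and M: "ideal M R"
  shows "subring (D <+>\<^bsub>R\<^esub> M) R"
proof -
  interpret M: ideal M R by fact
  note D' = subringE[OF D]
  note [simp] = D'(1)[THEN subsetD] M.Icarr
  show ?thesis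
  proof (rule subringI)
    show "D <+>\<^bsub>R\<^esub> M \<subseteq> carrier R"
      by (auto simp: set_add_def')
    show "\<one> \<in> D <+>\<^bsub>R\<^esub> M"
      using set_add_memI[OF D'(3) M.zero_closed, of R] by simp
  next
    fix h assume "h \<in> D <+>\<^bsub>R\<^esub> M"
    then obtain d m where h: "d \<in> D" "m \<in> M" "h = d \<oplus> m" by (auto simp: set_add_def')
    then have "\<ominus> h = \<ominus> d \<oplus> \<ominus> m" by (simp add: minus_add)
    then show "\<ominus> h \<in> D <+>\<^bsub>R\<^esub> M"
      using set_add_memI[OF D'(5)[OF h(1)] M.a_inv_closed[OF h(2)], of R] by simp
  next
    fix h1 h2 assume "h1 \<in> D <+>\<^bsub>R\<^esub> M" "h2 \<in> D <+>\<^bsub>R\<^esub> M"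
    then obtain d1 m1 d2 m2 where h: "d1 \<in> D" "m1 \<in> M" "h1 = d1 \<oplus> m1"
      "d2 \<in> D" "m2 \<in> M" "h2 = d2 \<oplus> m2" by (auto simp: set_add_def')
    have "h1 \<oplus> h2 = (d1 \<oplus> d2) \<oplus> (m1 \<oplus> m2)"
      using h by (simp add: a_ac)
    then show "h1 \<oplus> h2 \<in> D <+>\<^bsub>R\<^esub> M"
      using set_add_memI[OF D'(7)[OF h(1,4)] M.a_closed[OF h(2,5)], of R] by simp
    have "h1 \<otimes> h2 = (d1 \<otimes> d2) \<oplus> (d1 \<otimes> m2 \<oplus> m1 \<otimes> (d2 \<oplus> m2))"
      using h by (simp add: l_distr r_distr a_ac)
    moreover have "d1 \<otimes> m2 \<oplus> m1 \<otimes> (d2 \<oplus> m2) \<in> M"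
      using h M.I_l_closed M.I_r_closed M.a_closed by simp
    ultimately show "h1 \<otimes> h2 \<in> D <+>\<^bsub>R\<^esub> M"
      using set_add_memI[OF D'(6)[OF h(1,4)], of _ M R] by simp
  qed
qed

text \<open>Since a subfield meets a proper ideal only in zero, the decomposition of an element of \<open>K + M\<close>
is unique.\<close>
lemma (in domain) add_ideal_component_in_subfield:
  assumes "subfield K R" "ideal M R" "\<one> \<notin> M" "subring D R" "D \<subseteq> K"
    and "k \<in> K" "m \<in> M" "k \<oplus> m \<in> D <+>\<^bsub>R\<^esub> M"
  shows "k \<in> D"
proof -
  interpret M: ideal M R by fact
  note K' = subringE[OF subfieldE(1)[OF assms(1)]]
  obtain d n where d: "d \<in> D" "n \<in> M" "k \<oplus> m = d \<oplus> n"
    using assms(8) by (auto simp: set_add_def')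
  have c: "k \<in> carrier R" "d \<in> carrier R" "m \<in> carrier R" "n \<in> carrier R"
    using d assms K'(1) M.Icarr by auto
  have "k \<ominus> d = (k \<oplus> m) \<ominus> (d \<oplus> m)"
    using c by algebra
  also have "\<dots> = n \<ominus> m"
    unfolding d(3) using c by algebra
  finally have "k \<ominus> d \<in> M"
    using d assms(7) M.a_closed M.a_inv_closed by (simp add: a_minus_def)
  moreover have "k \<ominus> d \<in> K"
    using K'(5,7) assms(5,6) d(1) by (auto simp: a_minus_def)
  ultimately have "k \<ominus> d = \<zero>"
    using subfield_inter_ideal[OF assms(1-3)] by blast
  then have "k = d" using c by simp
  then show ?thesis using d(1) by simp
qed

lemma (in domain) unit_dense_subring_subfield_add_ideal:
  assumes K: "subfield K R" and M: "ideal M R" and one: "\<one> \<notin> M"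
    and T: "carrier R = K <+>\<^bsub>R\<^esub> M" and D: "subfield D R" "D \<subseteq> K"
  shows "unit_dense_subring R (D <+>\<^bsub>R\<^esub> M) M"
proof (intro unit_dense_subring.intro unit_dense_subring_axioms.intro domain_axioms)
  interpret M: ideal M R by fact
  note K' = subringE[OF subfieldE(1)[OF K]]
  note D' = subringE[OF subfieldE(1)[OF D(1)]]
  note [simp] = K'(1)[THEN subsetD] D'(1)[THEN subsetD] M.Icarr
  show "subring (D <+>\<^bsub>R\<^esub> M) R"
    by (rule subring_add_ideal[OF subfieldE(1)[OF D(1)] M])
  show "ideal M R" by fact
  show MS: "M \<subseteq> D <+>\<^bsub>R\<^esub> M"
  proof
    fix m assume "m \<in> M"
    then show "m \<in> D <+>\<^bsub>R\<^esub> M" using set_add_memI[OF D'(2), of m M R] by simp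
  qed
  show "\<one> \<notin> M" by fact
  fix x assume "x \<in> carrier R"
  then obtain k m where x: "k \<in> K" "m \<in> M" "x = k \<oplus> m"
    using T by (auto simp: set_add_def')
  show "\<exists>u\<in>Units R. u \<otimes> x \<in> D <+>\<^bsub>R\<^esub> M"
  proof (cases "k = \<zero>")
    case True
    then have "\<one> \<otimes> x \<in> D <+>\<^bsub>R\<^esub> M" using x MS by auto
    then show ?thesis using Units_one_closed by blast
  next
    case False
    note k = subfield_subset_Units[OF K x(1) False]
    have "inv k \<otimes> x = \<one> \<oplus> inv k \<otimes> m"
      using k x by (simp add: r_distr)
    then have "inv k \<otimes> x \<in> D <+>\<^bsub>R\<^esub> M"
      using set_add_memI[OF D'(3) M.I_l_closed[OF x(2)], of _ R] k by simp
    then show ?thesis using k(1) Units_inv_Units by blast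
  qed
next
  interpret M: ideal M R by fact
  note K' = subringE[OF subfieldE(1)[OF K]]
  note D' = subringE[OF subfieldE(1)[OF D(1)]]
  note [simp] = K'(1)[THEN subsetD] D'(1)[THEN subsetD] M.Icarr
  fix p t assume p: "p \<in> D <+>\<^bsub>R\<^esub> M" "p \<notin> M" and t: "t \<in> carrier R" "p \<otimes> t \<in> D <+>\<^bsub>R\<^esub> M"
  obtain d m where d: "d \<in> D" "m \<in> M" "p = d \<oplus> m"
    using p by (auto simp: set_add_def')
  obtain k n where k: "k \<in> K" "n \<in> M" "t = k \<oplus> n"
    using t(1) T by (auto simp: set_add_def')
  have "d \<noteq> \<zero>"
    using p(2) d(2,3) by auto
  have c: "d \<in> carrier R" "m \<in> carrier R" "k \<in> carrier R" "n \<in> carrier R"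
    using d k by simp_all
  have pt: "p \<otimes> t = d \<otimes> k \<oplus> (d \<otimes> n \<oplus> m \<otimes> (k \<oplus> n))"
    unfolding d(3) k(3) using c by algebra
  have "d \<otimes> n \<oplus> m \<otimes> (k \<oplus> n) \<in> M"
    using d k c M.I_l_closed M.I_r_closed M.a_closed by simp
  moreover have "d \<otimes> k \<in> K"
    using K'(6)[OF subsetD[OF D(2) d(1)] k(1)] .
  ultimately have "d \<otimes> k \<in> D"
    using add_ideal_component_in_subfield[OF K M one subfieldE(1)[OF D(1)] D(2)] t(2)
    unfolding pt by blast
  then have "k \<in> D"
    using subfield_m_inv_simprule[OF D(1), of d k] d(1) \<open>d \<noteq> \<zero>\<close> c(3) by simp
  then show "t \<in> D <+>\<^bsub>R\<^esub> M" using set_add_memI k(2,3) by simp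
qed

lemma finite_FactGroup_self:
  assumes "Group.group G"
  shows "finite (carrier (G Mod carrier G))"
proof -
  interpret Group.group G by fact
  have "carrier (G Mod carrier G) \<subseteq> {carrier G}"
    by (auto simp: carrier_FactGroup coset_join2 subgroup_self)
  then show ?thesis using finite_subset by blast
qed

section \<open>The TPDF property of \<open>D + M\<close>\<close>

theorem corollary4p10:
  fixes T :: "('a, 'b) ring_scheme" and R :: "('a, 'b) ring_scheme"
    and K D M :: "'a set"
  assumes "domain T"
    and "subfield K T"
    and "maximalideal M T" and "M \<noteq> {\<zero>\<^bsub>T\<^esub>}"
    and "carrier T = K <+>\<^bsub>T\<^esub> M"
    and "subfield D T" and "D \<subseteq> K"
    and "R = T\<lparr>carrier := D <+>\<^bsub>T\<^esub> M\<rparr>"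
  shows
    "(irreducibles R \<inter> M \<noteq> {} \<longrightarrow>
        (TPDF_domain R \<longleftrightarrow>
           TPDF_domain T \<and>
           (\<forall>a \<in> irreducibles R \<inter> M. ring_prime\<^bsub>R\<^esub> a) \<and>
           finite (carrier (Ring_Divisibility.mult_of (T\<lparr>carrier := K\<rparr>) Mod
                            carrier (Ring_Divisibility.mult_of (T\<lparr>carrier := D\<rparr>)))))) \<and>
     (irreducibles R \<inter> M = {} \<longrightarrow>
        (TPDF_domain R \<longleftrightarrow> TPDF_domain T))"
proof -
  interpret T: domain T by fact
  interpret M: maximalideal M T by fact
  have one: "\<one>\<^bsub>T\<^esub> \<notin> M"
    using M.I_notcarr M.one_imp_carrier by auto
  interpret S: unit_dense_subring T "D <+>\<^bsub>T\<^esub> M" M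
    by (rule T.unit_dense_subring_subfield_add_ideal[OF assms(2) M.is_ideal one assms(5-7)])
  note R = assms(8)
  have R_domain: "domain R"
    unfolding R by (rule S.R.domain_axioms)
  have prime_if_TPDF: "\<forall>a \<in> irreducibles R \<inter> M. ring_prime\<^bsub>R\<^esub> a" if "TPDF_domain R"
    using domain.irreducible_imp_prime_if_TPDF[OF R_domain that] by blast
  show ?thesis
  proof (intro conjI impI)
    assume "irreducibles R \<inter> M = {}"
    then show "TPDF_domain R \<longleftrightarrow> TPDF_domain T"
      using S.TPDF_subring_iff unfolding R by blast
  next
    assume ne: "irreducibles R \<inter> M \<noteq> {}"
    show "TPDF_domain R \<longleftrightarrow>
           TPDF_domain T \<and>
           (\<forall>a \<in> irreducibles R \<inter> M. ring_prime\<^bsub>R\<^esub> a) \<and>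
           finite (carrier (Ring_Divisibility.mult_of (T\<lparr>carrier := K\<rparr>) Mod
                            carrier (Ring_Divisibility.mult_of (T\<lparr>carrier := D\<rparr>))))"
    proof (cases "D = K")
      case True
      then have "R = T" using R assms(5) by simp
      moreover have "Group.group (Ring_Divisibility.mult_of (T\<lparr>carrier := K\<rparr>))"
        using field.field_mult_group[OF T.subfield_iff(2)[OF assms(2)]]
        by (simp add: Ring_Divisibility.mult_of_def Multiplicative_Group.mult_of_def)
      ultimately show ?thesis
        using prime_if_TPDF finite_FactGroup_self True by blast
    next
      case False
      then obtain k where k: "k \<in> K" "k \<notin> D" using assms(7) by blast
      have D0: "\<zero>\<^bsub>T\<^esub> \<in> D" using subringE(2)[OF subfieldE(1)[OF assms(6)]] .
      have "k \<noteq> \<zero>\<^bsub>T\<^esub>" using k D0 by auto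
      note unit = T.subfield_subset_Units[OF assms(2) k(1) this]
      have D_mem: "x \<in> D" if "x \<in> K" "x \<in> D <+>\<^bsub>T\<^esub> M" for x
        using T.add_ideal_component_in_subfield[OF assms(2) M.is_ideal one
            subfieldE(1)[OF assms(6)] assms(7) that(1) M.zero_closed] that
          subringE(1)[OF subfieldE(1)[OF assms(2)]] by auto
      have "inv\<^bsub>T\<^esub> k \<notin> D"
      proof
        assume "inv\<^bsub>T\<^esub> k \<in> D"
        moreover have "inv\<^bsub>T\<^esub> k \<noteq> \<zero>\<^bsub>T\<^esub>"
          using T.subfield_m_inv(1)[OF assms(2)] k \<open>k \<noteq> \<zero>\<^bsub>T\<^esub>\<close> by auto
        ultimately have "inv\<^bsub>T\<^esub> (inv\<^bsub>T\<^esub> k) \<in> D"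
          using T.subfield_subset_Units(2)[OF assms(6)] by blast
        then show False using unit(1) k(2) by simp
      qed
      then have "\<not> ring_prime\<^bsub>R\<^esub> p" if "p \<in> M" for p
        unfolding R using S.not_prime_in_M_if_new_unit[OF unit(1) _ _ that] D_mem k unit(2) by blast
      then show ?thesis
        using ne prime_if_TPDF by blast
    qed
  qed
qed

end
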